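(* Let $\mathbf B=\{b_{ij}\}_{i,j=1}^n$ be a real $n\times n$ matrix with $b_{ii}<0$ for all $i=1,\dots,n$, let $a<0$, and let $$\mathbf C=\begin{pmatrix} a\mathbf I & \mathbf B\\ \mathbf I & \mathbf O\end{pmatrix}$$ be the corresponding $2n\times 2n$ matrix ($\mathbf I$ is the $n\times n$ identity, $\mathbf O$ the $n\times n$ zero matrix). If $\mathbf B$ is $D$-negative, then $\mathbf C$ is $(\mathcal G_2,\diamond)$-stable.
   Context: A real square matrix is stable if all its eigenvalues have negative real parts. A positive diagonal matrix is a diagonal matrix with all diagonal entries positive. A real $n\times n$ matrix $\mathbf B$ is $D$-negative if all eigenvalues of $\mathbf D\mathbf B$ are (real and) negative for every positive diagonal $n\times n$ matrix $\mathbf D$. For real $2n\times 2n$ matrices partitioned into $n\times n$ blocks, $\mathbf H=(\mathbf H_{ij})_{i,j=1,2}$ and $\mathbf G=(\mathbf G_{ij})_{i,j=1,2}$, the block Hadamard product $\mathbf H\diamond\mathbf G$ is the matrix with blocks $\mathbf H_{ij}\mathbf G_{ij}$ (usual matrix products of blocks). $\mathcal G_2$ is the set of all $2n\times 2n$ matrices $\begin{pmatrix}\mathbf I&\mathbf D\\ \mathbf I&\mathbf I\end{pmatrix}$ with $\mathbf D$ an $n\times n$ positive diagonal matrix. A matrix $\mathbf C$ is $(\mathcal G_2,\diamond)$-stable if both $\mathbf G\diamond\mathbf C$ and $\mathbf C\diamond\mathbf G$ are stable for every $\mathbf G\in\mathcal G_2$. *)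

theory Defs
  imports Complex_Main "Jordan_Normal_Form.Char_Poly"
begin

text \<open>The eigenvalues of a real matrix are its complex eigenvalues, hence the
  coercion of the entries to \<^typ>\<open>complex\<close>.\<close>

definition stable_mat :: "real mat \<Rightarrow> bool" where
  "stable_mat A \<longleftrightarrow> square_mat A \<and>
     (\<forall>z. eigenvalue (map_mat complex_of_real A) z \<longrightarrow> Re z < 0)"

definition pos_diag_mat :: "nat \<Rightarrow> real mat \<Rightarrow> bool" where
  "pos_diag_mat n D \<longleftrightarrow> D \<in> carrier_mat n n \<and> diagonal_mat D \<and> (\<forall>i<n. D $$ (i, i) > 0)"

definition D_negative :: "nat \<Rightarrow> real mat \<Rightarrow> bool" where
  "D_negative n B \<longleftrightarrow> B \<in> carrier_mat n n \<and>
     (\<forall>D. pos_diag_mat n D \<longrightarrow>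
        (\<forall>z. eigenvalue (map_mat complex_of_real (D * B)) z \<longrightarrow> z \<in> \<real> \<and> Re z < 0))"

text \<open>The block Hadamard product is only meaningful for arguments in
  \<^term>\<open>carrier_mat (2 * n) (2 * n)\<close>, where all blocks are \<open>n \<times> n\<close>.\<close>

definition block_hadamard :: "nat \<Rightarrow> real mat \<Rightarrow> real mat \<Rightarrow> real mat" where
  "block_hadamard n H G =
     (case split_block H n n of (H11, H12, H21, H22) \<Rightarrow>
      case split_block G n n of (G11, G12, G21, G22) \<Rightarrow>
        four_block_mat (H11 * G11) (H12 * G12) (H21 * G21) (H22 * G22))"

definition G2 :: "nat \<Rightarrow> real mat set" where
  "G2 n = {four_block_mat (1\<^sub>m n) D (1\<^sub>m n) (1\<^sub>m n) | D. pos_diag_mat n D}"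

definition op_stable :: "real mat set \<Rightarrow> (real mat \<Rightarrow> real mat \<Rightarrow> real mat) \<Rightarrow> real mat \<Rightarrow> bool" where
  "op_stable \<G> f C \<longleftrightarrow> (\<forall>G\<in>\<G>. stable_mat (f G C) \<and> stable_mat (f C G))"

lemma block_hadamard_four_block:
  assumes "H11 \<in> carrier_mat n n" "H12 \<in> carrier_mat n n"
    "H21 \<in> carrier_mat n n" "H22 \<in> carrier_mat n n"
    "G11 \<in> carrier_mat n n" "G12 \<in> carrier_mat n n"
    "G21 \<in> carrier_mat n n" "G22 \<in> carrier_mat n n"
  shows "block_hadamard n (four_block_mat H11 H12 H21 H22) (four_block_mat G11 G12 G21 G22) =
    four_block_mat (H11 * G11) (H12 * G12) (H21 * G21) (H22 * G22)"
proof -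
  have split: "split_block (four_block_mat A B C D) n n = (A, B, C, D)"
    if "A \<in> carrier_mat n n" "B \<in> carrier_mat n n" "C \<in> carrier_mat n n" "D \<in> carrier_mat n n"
    for A B C D :: "real mat"
    using that by (auto simp: split_block_def Let_def intro!: eq_matI)
  show ?thesis
    using assms by (simp add: block_hadamard_def split)
qed

end

theory Submission
  imports Defs
begin

text \<open>Both products have the companion shape with blocks \<open>a I\<close>, \<open>E\<close>, \<open>I\<close>, \<open>O\<close>, where \<open>E\<close> is
  \<open>D B\<close> or \<open>B D\<close>. An eigenvector \<open>(x, y)\<close> for \<open>z\<close> satisfies \<open>x = z y\<close> and
  \<open>E y = z (z - a) y\<close>, so \<open>z (z - a)\<close> is an eigenvalue of \<open>E\<close> and hence a negative real
  (\<open>D B\<close> and \<open>B D\<close> have the same eigenvalues). Since \<open>a < 0\<close>, this forces \<open>Re z < 0\<close>.\<close>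

text \<open>For \<open>k \<noteq> 0\<close>, \<open>B\<close> carries an eigenvector
  \<open>v\<close> of \<open>A * B\<close> to an eigenvector \<open>B v\<close> of
  \<open>B * A\<close>. For \<open>k = 0\<close> the vector \<open>B v\<close> may vanish, so that
  case is settled by determinants.\<close>

lemma eigenvalue_mult_commute:
  fixes A B :: "'a :: field mat"
  assumes A: "A \<in> carrier_mat n n" and B: "B \<in> carrier_mat n n"
    and ev: "eigenvalue (A * B) k"
  shows "eigenvalue (B * A) k"
proof (cases "k = 0")
  case True
  \<comment> \<open>Having eigenvalue 0 means being singular, and
    \<open>det (A * B) = det A * det B\<close> is symmetric in the two factors.\<close>
  have "det (char_matrix (A * B) 0) = 0"
    using ev True A B eigenvalue_det[of "A * B" n 0] by auto
  moreover have "char_matrix (A * B) 0 = A * B" "char_matrix (B * A) 0 = B * A"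
    using A B by (auto simp: char_matrix_def)
  ultimately have "det (char_matrix (B * A) 0) = 0"
    using A B by (auto simp: det_mult)
  then show ?thesis
    using True A B eigenvalue_det[of "B * A" n 0] by auto
next
  case False
  obtain v where v: "v \<in> carrier_vec n" "v \<noteq> 0\<^sub>v n" and eq: "A *\<^sub>v (B *\<^sub>v v) = k \<cdot>\<^sub>v v"
    using ev A B unfolding eigenvalue_def eigenvector_def by auto
  have "B *\<^sub>v v \<noteq> 0\<^sub>v n"
  proof
    assume "B *\<^sub>v v = 0\<^sub>v n"
    then have "k \<cdot>\<^sub>v v = A *\<^sub>v 0\<^sub>v n"
      using eq by simp
    also have "\<dots> = 0\<^sub>v n"
      using A by (intro eq_vecI) auto
    finally have "k \<cdot>\<^sub>v v = 0\<^sub>v n" .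
    with False v show False
      by (auto simp: vec_eq_iff)
  qed
  moreover have "(B * A) *\<^sub>v (B *\<^sub>v v) = k \<cdot>\<^sub>v (B *\<^sub>v v)"
    using A B v eq by (simp add: assoc_mult_mat_vec[of B n n A n] mult_mat_vec[of B n n])
  ultimately show ?thesis
    using A B v unfolding eigenvalue_def eigenvector_def
    by (intro exI[of _ "B *\<^sub>v v"]) auto
qed

lemma eigenvalue_four_block_companion:
  fixes E :: "'a :: field mat"
  assumes E: "E \<in> carrier_mat n n"
    and ev: "eigenvalue (four_block_mat (c \<cdot>\<^sub>m 1\<^sub>m n) E (1\<^sub>m n) (0\<^sub>m n n)) z"
  shows "eigenvalue E (z * (z - c))"
proof -
  let ?M = "four_block_mat (c \<cdot>\<^sub>m 1\<^sub>m n) E (1\<^sub>m n) (0\<^sub>m n n)"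
  obtain v where v: "v \<in> carrier_vec (n + n)" "v \<noteq> 0\<^sub>v (n + n)" "?M *\<^sub>v v = z \<cdot>\<^sub>v v"
    using ev E unfolding eigenvalue_def eigenvector_def by auto
  define x y where "x = vec_first v n" and "y = vec_last v n"
  have xy: "x \<in> carrier_vec n" "y \<in> carrier_vec n" "v = x @\<^sub>v y"
    using v by (auto simp: x_def y_def)
  have cx: "c \<cdot>\<^sub>m 1\<^sub>m n *\<^sub>v x = c \<cdot>\<^sub>v x"
    using xy(1) by (intro eq_vecI) (auto simp: scalar_prod_left_unit row_smult)
  have "?M *\<^sub>v v = (c \<cdot>\<^sub>m 1\<^sub>m n *\<^sub>v x + E *\<^sub>v y) @\<^sub>v (1\<^sub>m n *\<^sub>v x + 0\<^sub>m n n *\<^sub>v y)"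
    unfolding xy(3) by (rule four_block_mat_mult_vec) (use E xy(1,2) in auto)
  moreover have "z \<cdot>\<^sub>v v = (z \<cdot>\<^sub>v x) @\<^sub>v (z \<cdot>\<^sub>v y)"
    unfolding xy(3) by (rule eq_vecI) (use xy(1,2) in auto)
  ultimately have "(c \<cdot>\<^sub>m 1\<^sub>m n *\<^sub>v x + E *\<^sub>v y) @\<^sub>v (1\<^sub>m n *\<^sub>v x + 0\<^sub>m n n *\<^sub>v y) =
      (z \<cdot>\<^sub>v x) @\<^sub>v (z \<cdot>\<^sub>v y)"
    using v(3) by argo
  \<comment> \<open>Equal lengths of the upper parts allow the equation to be split into its two
    block rows.\<close>
  moreover have "c \<cdot>\<^sub>m 1\<^sub>m n *\<^sub>v x + E *\<^sub>v y \<in> carrier_vec n" "z \<cdot>\<^sub>v x \<in> carrier_vec n"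
    using E xy(1,2) by (auto simp: cx)
  ultimately have *: "c \<cdot>\<^sub>m 1\<^sub>m n *\<^sub>v x + E *\<^sub>v y = z \<cdot>\<^sub>v x"
      "1\<^sub>m n *\<^sub>v x + 0\<^sub>m n n *\<^sub>v y = z \<cdot>\<^sub>v y"
    using append_vec_eq by blast+
  have "0\<^sub>m n n *\<^sub>v y = 0\<^sub>v n"
    using xy(2) by (intro eq_vecI) auto
  with *(2) xy(1) have x: "x = z \<cdot>\<^sub>v y"
    by simp
  from *(1)[unfolded cx] x have eq: "c \<cdot>\<^sub>v (z \<cdot>\<^sub>v y) + E *\<^sub>v y = z \<cdot>\<^sub>v (z \<cdot>\<^sub>v y)"
    by simp
  have "E *\<^sub>v y = (z * (z - c)) \<cdot>\<^sub>v y"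
  proof (rule eq_vecI)
    fix i assume "i < dim_vec ((z * (z - c)) \<cdot>\<^sub>v y)"
    then have i: "i < n" using xy(2) by simp
    have "(c \<cdot>\<^sub>v (z \<cdot>\<^sub>v y) + E *\<^sub>v y) $ i = (z \<cdot>\<^sub>v (z \<cdot>\<^sub>v y)) $ i"
      by (simp only: eq)
    \<comment> \<open>The entry of \<open>E y\<close> is kept as an atom, not expanded into a scalar
      product, so that only a scalar equation remains to be solved for it.\<close>
    then have "c * (z * y $ i) + (E *\<^sub>v y) $ i = z * (z * y $ i)"
      using i xy(2) E by (simp del: index_mult_mat_vec)
    then show "(E *\<^sub>v y) $ i = ((z * (z - c)) \<cdot>\<^sub>v y) $ i"
      using i xy(2) by (simp add: algebra_simps del: index_mult_mat_vec)
  qed (use E xy(2) in auto)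
  \<comment> \<open>If \<open>y\<close> were zero, \<open>x = z y\<close> would vanish too, and with
    it the whole eigenvector.\<close>
  moreover have "y \<noteq> 0\<^sub>v n"
    using v(2) xy(3) x by auto
  ultimately show ?thesis
    using E xy(2) unfolding eigenvalue_def eigenvector_def by auto
qed

text \<open>If \<open>Re z \<ge> 0\<close>, then \<open>2 Re z - a > 0\<close>, so a vanishing
  imaginary part \<open>Im z (2 Re z - a)\<close> makes \<open>z\<close> real; but then
  \<open>z (z - a)\<close> is a product of nonnegative reals.\<close>

lemma quadratic_root_Re_neg:
  fixes z :: complex and a :: real
  assumes a: "a < 0" and w: "z * (z - of_real a) \<in> \<real>" "Re (z * (z - of_real a)) < 0"
  shows "Re z < 0"
proof (rule ccontr)
  assume "\<not> Re z < 0"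
  then have Re: "Re z \<ge> 0" by simp
  have "Im z * (2 * Re z - a) = 0"
    using w(1) by (simp add: complex_is_Real_iff algebra_simps)
  then have "Im z = 0"
    using Re a by auto
  then have "Re z * (Re z - a) < 0"
    using w(2) by simp
  then show False
    using Re a by (simp add: mult_less_0_iff)
qed

lemma stable_mat_four_block_companion:
  fixes E :: "real mat"
  assumes E: "E \<in> carrier_mat n n" and a: "a < 0"
    and neg: "\<And>w. eigenvalue (map_mat complex_of_real E) w \<Longrightarrow> w \<in> \<real> \<and> Re w < 0"
  shows "stable_mat (four_block_mat (a \<cdot>\<^sub>m 1\<^sub>m n) E (1\<^sub>m n) (0\<^sub>m n n))"
proof -
  have map: "map_mat complex_of_real (four_block_mat (a \<cdot>\<^sub>m 1\<^sub>m n) E (1\<^sub>m n) (0\<^sub>m n n)) =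
    four_block_mat (of_real a \<cdot>\<^sub>m 1\<^sub>m n) (map_mat of_real E) (1\<^sub>m n) (0\<^sub>m n n)"
    using E by (intro eq_matI) auto
  have "Re z < 0"
    if "eigenvalue (map_mat complex_of_real (four_block_mat (a \<cdot>\<^sub>m 1\<^sub>m n) E (1\<^sub>m n) (0\<^sub>m n n))) z"
    for z
  proof -
    have "eigenvalue (map_mat complex_of_real E) (z * (z - of_real a))"
      using that E unfolding map by (intro eigenvalue_four_block_companion) auto
    from neg[OF this] show ?thesis
      using quadratic_root_Re_neg[OF a] by blast
  qed
  then show ?thesis
    using E by (auto simp: stable_mat_def)
qed

theorem theorem3:
  fixes n :: nat and B :: "real mat" and a :: real
  assumes "B \<in> carrier_mat n n"
    and "\<And>i. i < n \<Longrightarrow> B $$ (i, i) < 0"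
    and "a < 0"
    and "D_negative n B"
  shows "op_stable (G2 n) (block_hadamard n)
           (four_block_mat (a \<cdot>\<^sub>m 1\<^sub>m n) B (1\<^sub>m n) (0\<^sub>m n n))"
proof -
  let ?C = "four_block_mat (a \<cdot>\<^sub>m 1\<^sub>m n) B (1\<^sub>m n) (0\<^sub>m n n)"
  note B = assms(1)
  have "stable_mat (block_hadamard n G ?C) \<and> stable_mat (block_hadamard n ?C G)"
    if G: "G \<in> G2 n" for G
  proof -
    obtain D where D: "pos_diag_mat n D" and G_eq: "G = four_block_mat (1\<^sub>m n) D (1\<^sub>m n) (1\<^sub>m n)"
      using G by (auto simp: G2_def)
    have D': "D \<in> carrier_mat n n"
      using D by (simp add: pos_diag_mat_def)
    have DB: "w \<in> \<real> \<and> Re w < 0" if "eigenvalue (map_mat complex_of_real (D * B)) w" for w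
      using assms(4) D that unfolding D_negative_def by blast
    \<comment> \<open>\<open>D\<close>-negativity speaks only of \<open>D * B\<close>; swapping the
      factors over the complex numbers transfers it to \<open>B * D\<close>.\<close>
    have "eigenvalue (map_mat complex_of_real (D * B)) w"
      if "eigenvalue (map_mat complex_of_real (B * D)) w" for w
      using that B D' eigenvalue_mult_commute[of "map_mat complex_of_real B" n "map_mat complex_of_real D" w]
      by (simp add: of_real_hom.mat_hom_mult)
    with DB have BD: "w \<in> \<real> \<and> Re w < 0" if "eigenvalue (map_mat complex_of_real (B * D)) w" for w
      using that by blast
    \<comment> \<open>Apart from \<open>D\<close>, all blocks of \<open>G\<close> are identities, so
      only the upper right block of \<open>?C\<close> changes; the order of the product decides
      between \<open>D * B\<close> and \<open>B * D\<close>.\<close>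
    have "block_hadamard n G ?C = four_block_mat (a \<cdot>\<^sub>m 1\<^sub>m n) (D * B) (1\<^sub>m n) (0\<^sub>m n n)"
      using B D' unfolding G_eq by (subst block_hadamard_four_block) auto
    moreover have "block_hadamard n ?C G = four_block_mat (a \<cdot>\<^sub>m 1\<^sub>m n) (B * D) (1\<^sub>m n) (0\<^sub>m n n)"
      using B D' unfolding G_eq by (subst block_hadamard_four_block) auto
    ultimately show ?thesis
      using stable_mat_four_block_companion[of _ n a] B D' assms(3) DB BD by simp
  qed
  then show ?thesis
    by (simp add: op_stable_def)
qed

end
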